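(* If a dataflow graph $G$ has a correct single-ring seating with window $W$, at any period and with any number of relays, then its routed cyclic value-cutwidth satisfies $\mathrm{vcw}_\circ(G)\le 2W$, and its linear value-cutwidth satisfies $\mathrm{vcw}(G)\le 4W$.
   Context: Dataflow graph: a DAG of operations and seeds (input values); each operation reads values and produces one value; the operations reading a value are its consumers. Single-ring seating with window $W$. A ring is a cyclic array of slots; packets (values/copies of values, instructions, relay instructions, or empty) occupy slots, one packet per slot (injectively), each copy holding one value. An instruction reads its operands from copies located at most $W$ slots ahead of itself and writes its result (a copy of the produced value) at most $W$ slots ahead of itself; a relay is an instruction that reads a copy of a value at most $W$ ahead and writes another copy of that value at most $W$ ahead. In a correct seating each operand of each operation is obtained in this way: either directly from the produced (or seeded) copy or through a chain of relay copies originating there. Each read of a value $v$ is a link: the cyclic interval from the reading instruction's slot to the copy's slot, of length $\le W$. A chain of links through relay copies carries $v$ from producer to consumer along one arc, and the seating's cyclic order of packets with its chains is a cyclic order with routes in the following sense. Value-cutwidth. Fix a cyclic order of $G$'s operations and seeds and, for each value $v$ and each of its consumers, one of the two arcs from $v$'s producer (or seed) to that consumer, its route. Value $v$ crosses a cut position $c$ (a point between two consecutive positions) if $c$ lies on one of $v$'s routes. $\mathrm{vcw}_\circ(G)$ is the minimum, over cyclic orders and route choices, of the maximum number of values crossing a cut; $\mathrm{vcw}(G)$ is the same over linear orders, where each dependence has one route (the interval between producer and consumer). *)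

theory Defs
  imports Main
begin

text \<open>Every operation and every seed has exactly one value, so values are identified with the
  operations and seeds they come from.  The consumers of \<open>v\<close> are the operations \<open>u\<close> with
  \<open>v \<in> operands G u\<close>.\<close>

record 'v dataflow =
  ops :: "'v set"
  seeds :: "'v set"
  operands :: "'v \<Rightarrow> 'v set"

definition nodes :: "'v dataflow \<Rightarrow> 'v set" where
  "nodes G = ops G \<union> seeds G"

definition dependences :: "'v dataflow \<Rightarrow> ('v \<times> 'v) set" where
  "dependences G = {(v, u). u \<in> ops G \<and> v \<in> operands G u}"

definition dataflow_graph :: "'v dataflow \<Rightarrow> bool" where
  "dataflow_graph G \<longleftrightarrow>
     finite (nodes G) \<and> ops G \<inter> seeds G = {} \<and>
     (\<forall>u\<in>ops G. operands G u \<subseteq> nodes G) \<and>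
     acyclic (dependences G)"

text \<open>Number of steps forward from position \<open>i\<close> to position \<open>j\<close> on a cycle of \<open>n\<close> positions
  (for \<open>i, j < n\<close>).\<close>

definition ahead :: "nat \<Rightarrow> nat \<Rightarrow> nat \<Rightarrow> nat" where
  "ahead n i j = (j + n - i) mod n"


text \<open>An order of the nodes is a bijection onto the positions \<open>0, \<dots>, n - 1\<close>.  For cyclic orders
  the positions are read modulo \<open>n\<close>; for linear orders they are not.  The order need not be
  compatible with the dependences.\<close>

definition node_order :: "'v dataflow \<Rightarrow> ('v \<Rightarrow> nat) \<Rightarrow> bool" where
  "node_order G p \<longleftrightarrow> bij_betw p (nodes G) {..<card (nodes G)}"

text \<open>Cut \<open>c\<close> is the point between position \<open>c\<close> and its successor, so a cyclic order has cuts
  \<open>0, \<dots>, n - 1\<close> and a linear one only \<open>0, \<dots>, n - 2\<close>.\<close>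

definition forward_arc :: "nat \<Rightarrow> nat \<Rightarrow> nat \<Rightarrow> nat set" where
  "forward_arc n i j = {c. c < n \<and> ahead n i c < ahead n i j}"

text \<open>The choice \<open>d v u\<close> selects which of the two arcs between \<open>v\<close> and its consumer \<open>u\<close> is the
  route; the arc leaving \<open>v\<close> backwards has the same cuts as the forward arc from \<open>u\<close> to \<open>v\<close>.\<close>

definition cyclic_route ::
  "'v dataflow \<Rightarrow> ('v \<Rightarrow> nat) \<Rightarrow> ('v \<Rightarrow> 'v \<Rightarrow> bool) \<Rightarrow> 'v \<Rightarrow> 'v \<Rightarrow> nat set" where
  "cyclic_route G p d v u =
     (if d v u then forward_arc (card (nodes G)) (p v) (p u)
      else forward_arc (card (nodes G)) (p u) (p v))"

definition linear_route :: "('v \<Rightarrow> nat) \<Rightarrow> 'v \<Rightarrow> 'v \<Rightarrow> nat set" where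
  "linear_route p v u = {min (p v) (p u)..<max (p v) (p u)}"

definition crossing :: "'v dataflow \<Rightarrow> ('v \<Rightarrow> 'v \<Rightarrow> nat set) \<Rightarrow> nat \<Rightarrow> 'v set" where
  "crossing G route c = {v. \<exists>u. (v, u) \<in> dependences G \<and> c \<in> route v u}"

text \<open>On the natural numbers \<open>Sup\<close> of a finite set is its maximum, and \<open>0\<close> if there is no cut.\<close>

definition cyclic_width :: "'v dataflow \<Rightarrow> ('v \<Rightarrow> nat) \<Rightarrow> ('v \<Rightarrow> 'v \<Rightarrow> bool) \<Rightarrow> nat" where
  "cyclic_width G p d =
     (SUP c\<in>{..<card (nodes G)}. card (crossing G (cyclic_route G p d) c))"

definition linear_width :: "'v dataflow \<Rightarrow> ('v \<Rightarrow> nat) \<Rightarrow> nat" where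
  "linear_width G p =
     (SUP c\<in>{..<card (nodes G) - 1}. card (crossing G (linear_route p) c))"

definition vcw_cyclic :: "'v dataflow \<Rightarrow> nat" where
  "vcw_cyclic G = Inf {cyclic_width G p d | p d. node_order G p}"

definition vcw :: "'v dataflow \<Rightarrow> nat" where
  "vcw G = Inf {linear_width G p | p. node_order G p}"


text \<open>\<open>Original v\<close> is the copy written by the instruction of \<open>v\<close> if \<open>v\<close> is an operation, and the
  seeded copy if \<open>v\<close> is a seed; \<open>Relayed r\<close> is the copy written by relay \<open>r\<close>.  Slots occupied by
  none of the packets below are the empty ones.\<close>

datatype ('v, 'r) copy = Original 'v | Relayed 'r

datatype ('v, 'r) packet = Instruction 'v | Relay 'r | Copy "('v, 'r) copy"

record ('v, 'r) seating =
  slots :: nat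
  relays :: "'r set"
  slot_of :: "('v, 'r) packet \<Rightarrow> nat"
  relay_value :: "'r \<Rightarrow> 'v"
  relay_source :: "'r \<Rightarrow> ('v, 'r) copy"
  operand_source :: "'v \<Rightarrow> 'v \<Rightarrow> ('v, 'r) copy" \<comment> \<open>operation, then operand\<close>

definition copies :: "'v dataflow \<Rightarrow> ('v, 'r) seating \<Rightarrow> ('v, 'r) copy set" where
  "copies G S = Original ` nodes G \<union> Relayed ` relays S"

definition packets :: "'v dataflow \<Rightarrow> ('v, 'r) seating \<Rightarrow> ('v, 'r) packet set" where
  "packets G S = Instruction ` ops G \<union> Relay ` relays S \<union> Copy ` copies G S"

fun held_value :: "('v, 'r) seating \<Rightarrow> ('v, 'r) copy \<Rightarrow> 'v" where
  "held_value S (Original v) = v"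
| "held_value S (Relayed r) = relay_value S r"

definition reaches :: "('v, 'r) seating \<Rightarrow> nat \<Rightarrow> ('v, 'r) packet \<Rightarrow> ('v, 'r) copy \<Rightarrow> bool" where
  "reaches S W i k \<longleftrightarrow> ahead (slots S) (slot_of S i) (slot_of S (Copy k)) \<le> W"

text \<open>Requiring matching values alone would admit relays that read each other's copies in a
  circle; a copy only counts if its chain of relays starts at the original copy.\<close>

inductive chain :: "('v, 'r) seating \<Rightarrow> 'v \<Rightarrow> ('v, 'r) copy \<Rightarrow> bool" for S v where
  original: "chain S v (Original v)"
| relayed: "r \<in> relays S \<Longrightarrow> relay_value S r = v \<Longrightarrow> chain S v (relay_source S r) \<Longrightarrow>
    chain S v (Relayed r)"

definition correct_seating :: "'v dataflow \<Rightarrow> nat \<Rightarrow> ('v, 'r) seating \<Rightarrow> bool" where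
  "correct_seating G W S \<longleftrightarrow>
     slots S > 0 \<and>
     inj_on (slot_of S) (packets G S) \<and>
     slot_of S ` packets G S \<subseteq> {..<slots S} \<and>
     (\<forall>u\<in>ops G. reaches S W (Instruction u) (Original u)) \<and>
     (\<forall>r\<in>relays S.
        relay_value S r \<in> nodes G \<and>
        relay_source S r \<in> copies G S \<and>
        held_value S (relay_source S r) = relay_value S r \<and>
        reaches S W (Relay r) (relay_source S r) \<and>
        reaches S W (Relay r) (Relayed r)) \<and>
     (\<forall>u\<in>ops G. \<forall>v\<in>operands G u.
        chain S v (operand_source S u v) \<and>
        reaches S W (Instruction u) (operand_source S u v))"

end

theory Submission
  imports Defs
begin

text \<open>Place every operation at the slot of its instruction and every seed at the slot of its
  seeded copy.  Every link of a value \<open>v\<close>, whether a read or a write, runs forward from an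
  instruction or relay to a copy of \<open>v\<close> at most \<open>W\<close> slots ahead; hence a cut crossed by a link of
  \<open>v\<close> has a copy of \<open>v\<close> among the \<open>W\<close> slots that follow it, and since a slot holds at most one
  copy, at most \<open>W\<close> values have a link across a given cut.  The chain of links from a producer to
  a consumer is connected, so it covers one of the two arcs between them, and that arc is taken
  as the route.  This gives cyclic width at most \<open>W\<close>; opening the cycle at its last cut costs at
  most another \<open>W\<close>.\<close>

section \<open>Arcs on a cycle of positions\<close>

lemma ahead_eq:
  assumes "i < n" "j < n"
  shows "ahead n i j = (if i \<le> j then j - i else j + n - i)"
proof (cases "i \<le> j")
  case True
  then have "j + n - i = (j - i) + n" by simp
  then have "ahead n i j = (j - i) mod n" by (simp only: ahead_def mod_add_self2)
  then show ?thesis using assms True by simp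
next
  case False
  then show ?thesis using assms unfolding ahead_def by simp
qed

lemma mem_forward_arc_iff:
  assumes "i < n" "j < n"
  shows "c \<in> forward_arc n i j \<longleftrightarrow>
    c < n \<and> (if i \<le> j then i \<le> c \<and> c < j else i \<le> c \<or> c < j)"
  using assms by (cases "c < n") (auto simp: forward_arc_def ahead_eq split: if_splits)

lemma mem_forward_arc_imp_ahead:
  assumes "i < n" "j < n" "c \<in> forward_arc n i j"
  shows "0 < ahead n c j" "ahead n c j \<le> ahead n i j"
  using assms by (auto simp: mem_forward_arc_iff ahead_eq split: if_splits)

lemma inj_on_ahead:
  assumes "c < n"
  shows "inj_on (ahead n c) {..<n}"
  using assms by (auto simp: inj_on_def ahead_eq split: if_splits)

text \<open>With cuts read as the edges of an \<open>n\<close>-cycle, this is connectedness of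
  \<open>i\<close> and \<open>j\<close> using only edges in \<open>X\<close>.\<close>

definition arc_joined :: "nat \<Rightarrow> nat set \<Rightarrow> nat \<Rightarrow> nat \<Rightarrow> bool" where
  "arc_joined n X i j \<longleftrightarrow> forward_arc n i j \<subseteq> X \<or> forward_arc n j i \<subseteq> X"

lemma arc_joined_refl: "arc_joined n X i i"
  by (simp add: arc_joined_def forward_arc_def ahead_def)

lemma arc_joined_sym: "arc_joined n X i j \<Longrightarrow> arc_joined n X j i"
  by (auto simp: arc_joined_def)

lemma arc_joined_trans:
  assumes "i < n" "j < n" "k < n" "arc_joined n X i j" "arc_joined n X j k"
  shows "arc_joined n X i k"
proof -
  \<comment> \<open>Facts 1 and 2 settle two arcs of the same orientation. In the mixed cases both
    arcs end at \<open>j\<close> (fact 3) or both start there (fact 4), so one is nested in the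
    other and the longer one contains an arc between \<open>i\<close> and \<open>k\<close>.\<close>
  have 1: "forward_arc n i k \<subseteq> forward_arc n i j \<union> forward_arc n j k"
    using assms(1-3) by (auto simp: mem_forward_arc_iff split: if_splits)
  have 2: "forward_arc n k i \<subseteq> forward_arc n k j \<union> forward_arc n j i"
    using assms(1-3) by (auto simp: mem_forward_arc_iff split: if_splits)
  have 3: "forward_arc n i k \<subseteq> forward_arc n i j \<or> forward_arc n k i \<subseteq> forward_arc n k j"
    using assms(1-3) by (auto simp: subset_iff mem_forward_arc_iff split: if_splits)
  have 4: "forward_arc n i k \<subseteq> forward_arc n j k \<or> forward_arc n k i \<subseteq> forward_arc n j i"
    using assms(1-3) by (auto simp: subset_iff mem_forward_arc_iff split: if_splits)
  show ?thesis
    using assms(4,5) 1 2 3 4 unfolding arc_joined_def by blast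
qed

section \<open>Links of a seating and the cuts they may cross\<close>

definition node_packet :: "'v dataflow \<Rightarrow> 'v \<Rightarrow> ('v, 'r) packet" where
  "node_packet G v = (if v \<in> ops G then Instruction v else Copy (Original v))"

definition node_slot :: "'v dataflow \<Rightarrow> ('v, 'r) seating \<Rightarrow> 'v \<Rightarrow> nat" where
  "node_slot G S v = slot_of S (node_packet G v)"

definition copies_of :: "'v dataflow \<Rightarrow> ('v, 'r) seating \<Rightarrow> 'v \<Rightarrow> ('v, 'r) copy set" where
  "copies_of G S v = {k \<in> copies G S. held_value S k = v}"

text \<open>Contains every cut that a link of \<open>v\<close> can cross, but depends only on where
  the copies sit. Distances start at 1 because cut \<open>c\<close> comes just after slot
  \<open>c\<close>, so a copy in slot \<open>c\<close> lies behind it.\<close>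

definition shadow :: "'v dataflow \<Rightarrow> nat \<Rightarrow> ('v, 'r) seating \<Rightarrow> 'v \<Rightarrow> nat set" where
  "shadow G W S v = {c. c < slots S \<and>
     (\<exists>k\<in>copies_of G S v. ahead (slots S) c (slot_of S (Copy k)) \<in> {1..W})}"

lemma node_packet_in_packets: "v \<in> nodes G \<Longrightarrow> node_packet G v \<in> packets G S"
  by (auto simp: node_packet_def packets_def copies_def nodes_def)

lemma slot_of_less:
  "correct_seating G W S \<Longrightarrow> x \<in> packets G S \<Longrightarrow> slot_of S x < slots S"
  by (auto simp: correct_seating_def)

lemma node_slot_less: "correct_seating G W S \<Longrightarrow> v \<in> nodes G \<Longrightarrow> node_slot G S v < slots S"
  by (simp add: node_slot_def slot_of_less node_packet_in_packets)

lemma inj_on_node_slot: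
  assumes "correct_seating G W S"
  shows "inj_on (node_slot G S) (nodes G)"
proof (rule inj_onI)
  fix u v assume uv: "u \<in> nodes G" "v \<in> nodes G" "node_slot G S u = node_slot G S v"
  have "inj_on (slot_of S) (packets G S)"
    using assms by (simp add: correct_seating_def)
  with uv have "(node_packet G u :: ('a, 'b) packet) = node_packet G v"
    unfolding node_slot_def by (metis inj_onD node_packet_in_packets)
  then show "u = v"
    by (auto simp: node_packet_def split: if_splits)
qed

lemma card_shadows_le:
  assumes S: "correct_seating G W S"
  shows "finite {v. c \<in> shadow G W S v}" "card {v. c \<in> shadow G W S v} \<le> W"
proof -
  define f where "f k = ahead (slots S) c (slot_of S (Copy k))" for k
  \<comment> \<open>Including \<open>c < slots S\<close> makes \<open>K\<close> empty for a
    \<open>c\<close> off the ring, in agreement with \<open>shadow\<close>.\<close>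
  define K where "K = {k \<in> copies G S. c < slots S \<and> f k \<in> {1..W}}"
  have inj: "inj_on (slot_of S) (packets G S)"
    using S by (simp add: correct_seating_def)
  have "inj_on f K"
  proof (rule inj_onI)
    fix k l assume kl: "k \<in> K" "l \<in> K" "f k = f l"
    then have pk: "Copy k \<in> packets G S" "Copy l \<in> packets G S"
      by (auto simp: K_def packets_def)
    have "c < slots S" using kl by (simp add: K_def)
    from inj_on_ahead[OF this] kl(3) pk have "slot_of S (Copy k) = slot_of S (Copy l)"
      unfolding f_def by (metis S inj_onD lessThan_iff slot_of_less)
    with inj pk show "k = l" by (auto dest: inj_onD)
  qed
  moreover have "f ` K \<subseteq> {1..W}" by (auto simp: K_def)
  ultimately have K: "finite K" "card K \<le> W"
    using inj_on_finite[of f K "{1..W}"] card_inj_on_le[of f K "{1..W}"] by auto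
  \<comment> \<open>Several copies in \<open>K\<close> may hold the same value, so values are at
    most as many as copies.\<close>
  have eq: "{v. c \<in> shadow G W S v} = held_value S ` K"
    by (auto simp: shadow_def K_def f_def copies_of_def)
  show "finite {v. c \<in> shadow G W S v}" using K eq by simp
  show "card {v. c \<in> shadow G W S v} \<le> W"
    using K eq card_image_le[of K "held_value S"] by simp
qed

text \<open>Walking from \<open>x\<close> towards the copy only shortens the distance to it, so each
  cut on the link still has the copy within \<open>W\<close>.\<close>

lemma link_joined:
  assumes S: "correct_seating G W S" and "x \<in> packets G S" "k \<in> copies_of G S v"
    and "reaches S W x k"
  shows "arc_joined (slots S) (shadow G W S v) (slot_of S x) (slot_of S (Copy k))"
proof -
  have "Copy k \<in> packets G S"
    using assms(3) by (simp add: copies_of_def packets_def)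
  then have less: "slot_of S x < slots S" "slot_of S (Copy k) < slots S"
    using S assms(2) by (auto intro: slot_of_less)
  have "forward_arc (slots S) (slot_of S x) (slot_of S (Copy k)) \<subseteq> shadow G W S v"
  proof
    fix c assume c: "c \<in> forward_arc (slots S) (slot_of S x) (slot_of S (Copy k))"
    have "ahead (slots S) c (slot_of S (Copy k)) \<in> {1..W}"
      using mem_forward_arc_imp_ahead[OF less c] assms(4) by (simp add: reaches_def)
    with c assms(3) show "c \<in> shadow G W S v"
      by (auto simp: shadow_def forward_arc_def)
  qed
  then show ?thesis by (simp add: arc_joined_def)
qed

lemma chain_copies_of:
  "chain S v k \<Longrightarrow> v \<in> nodes G \<Longrightarrow> k \<in> copies_of G S v"
  by (induction rule: chain.induct) (auto simp: copies_of_def copies_def)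

text \<open>Induction along the chain: each relay prolongs it by two links, its read and its write,
  which meet at the relay's own slot.\<close>

lemma chain_joined:
  assumes S: "correct_seating G W S" and v: "v \<in> nodes G" and "chain S v k"
  shows "arc_joined (slots S) (shadow G W S v) (node_slot G S v) (slot_of S (Copy k))"
  using assms(3)
proof induction
  case original
  show ?case
  proof (cases "v \<in> ops G")
    case True
    then have "reaches S W (Instruction v) (Original v)"
      using S by (simp add: correct_seating_def)
    moreover have "Instruction v \<in> packets G S"
      using True by (simp add: packets_def)
    ultimately show ?thesis
      using True link_joined[OF S _ chain_copies_of[OF chain.original v]]
      by (simp add: node_slot_def node_packet_def)
  next
    case False
    \<comment> \<open>A seed is placed at its own copy, so the arc is empty.\<close>
    then show ?thesis by (simp add: node_slot_def node_packet_def arc_joined_refl)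
  qed
next
  case (relayed r)
  let ?k = "relay_source S r"
  have pr: "Relay r \<in> packets G S" using relayed by (simp add: packets_def)
  have k: "?k \<in> copies_of G S v" using relayed v by (auto intro: chain_copies_of)
  have r: "Relayed r \<in> copies_of G S v"
    using chain.relayed[OF relayed.hyps] v by (rule chain_copies_of)
  have pk: "Copy ?k \<in> packets G S" "Copy (Relayed r) \<in> packets G S"
    using k r by (simp_all add: copies_of_def packets_def)
  have "reaches S W (Relay r) ?k" "reaches S W (Relay r) (Relayed r)"
    using S relayed by (simp_all add: correct_seating_def)
  then have "arc_joined (slots S) (shadow G W S v) (slot_of S (Copy ?k)) (slot_of S (Relay r))"
      "arc_joined (slots S) (shadow G W S v) (slot_of S (Relay r)) (slot_of S (Copy (Relayed r)))"
    using link_joined[OF S pr k] link_joined[OF S pr r] by (auto intro: arc_joined_sym)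
  with relayed.IH show ?case
    using arc_joined_trans slot_of_less[OF S] node_slot_less[OF S v] pr pk by metis
qed

text \<open>The consumer's read link is appended to the chain carrying its operand.\<close>

lemma dependence_joined:
  assumes G: "dataflow_graph G" and S: "correct_seating G W S" and vu: "(v, u) \<in> dependences G"
  shows "arc_joined (slots S) (shadow G W S v) (node_slot G S v) (node_slot G S u)"
proof -
  let ?k = "operand_source S u v"
  have u: "u \<in> ops G" "v \<in> operands G u" using vu by (auto simp: dependences_def)
  then have v: "v \<in> nodes G" using G by (auto simp: dataflow_graph_def)
  have c: "chain S v ?k" "reaches S W (Instruction u) ?k"
    using S u by (auto simp: correct_seating_def)
  have k: "?k \<in> copies_of G S v" using c v by (auto intro: chain_copies_of)
  have p: "Instruction u \<in> packets G S" "Copy ?k \<in> packets G S"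
    using u k by (auto simp: packets_def copies_of_def)
  have "arc_joined (slots S) (shadow G W S v) (slot_of S (Copy ?k)) (slot_of S (Instruction u))"
    using link_joined[OF S p(1) k c(2)] by (rule arc_joined_sym)
  moreover have "node_slot G S u = slot_of S (Instruction u)"
    using u by (simp add: node_slot_def node_packet_def)
  ultimately show ?thesis
    using arc_joined_trans chain_joined[OF S v c(1)] slot_of_less[OF S] node_slot_less[OF S v] p
    by metis
qed

section \<open>From slots to positions, and the two widths\<close>

lemma ex_rank:
  fixes s :: "'a \<Rightarrow> nat"
  assumes "finite A" "inj_on s A"
  obtains p where "bij_betw p A {..<card A}"
    "\<And>a b. a \<in> A \<Longrightarrow> b \<in> A \<Longrightarrow> p a < p b \<longleftrightarrow> s a < s b"
proof -
  \<comment> \<open>The rank squeezes out slots holding no node. Since \<open>a\<close> does not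
    count itself, ranks stay below \<open>card A\<close>; injectivity then makes them exhaust all
    positions.\<close>
  define p where "p a = card {b \<in> A. s b < s a}" for a
  have less: "p a < p b" if "a \<in> A" "b \<in> A" "s a < s b" for a b
    unfolding p_def using that assms(1) by (intro psubset_card_mono) auto
  have iff: "p a < p b \<longleftrightarrow> s a < s b" if "a \<in> A" "b \<in> A" for a b
    using less[OF that] less[OF that(2,1)] that assms(2)
    by (metis inj_on_eq_iff less_asym less_irrefl linorder_neqE_nat)
  have inj: "inj_on p A"
    by (rule inj_onI) (metis assms(2) iff inj_onD less_irrefl linorder_neqE_nat)
  have "p ` A \<subseteq> {..<card A}"
    unfolding p_def using assms(1) by (auto intro!: psubset_card_mono)
  then have "p ` A = {..<card A}"
    using inj by (intro card_subset_eq) (auto simp: card_image)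
  with inj iff that show thesis by (auto simp: bij_betw_def)
qed

lemma SUP_nat_le:
  fixes f :: "'a \<Rightarrow> nat"
  assumes "\<And>c. c \<in> A \<Longrightarrow> f c \<le> b"
  shows "(SUP c\<in>A. f c) \<le> b"
proof (cases "A = {}")
  case True
  \<comment> \<open>With no cuts, the default value \<open>Sup {} = 0\<close> applies.\<close>
  then show ?thesis by (simp add: Sup_nat_def)
next
  case False
  then show ?thesis using assms by (rule cSUP_least)
qed

lemma vcw_cyclic_le: "node_order G p \<Longrightarrow> cyclic_width G p d \<le> b \<Longrightarrow> vcw_cyclic G \<le> b"
  unfolding vcw_cyclic_def by (rule order_trans[OF cInf_lower]) auto

lemma vcw_le: "node_order G p \<Longrightarrow> linear_width G p \<le> b \<Longrightarrow> vcw G \<le> b"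
  unfolding vcw_def by (rule order_trans[OF cInf_lower]) auto

text \<open>A cyclic route either is the interval between the two positions or wraps around, and
  then it contains the last cut.\<close>

lemma linear_route_subset_cyclic_route:
  assumes "p v < card (nodes G)" "p u < card (nodes G)" "c \<in> linear_route p v u"
  shows "c \<in> cyclic_route G p d v u \<or> card (nodes G) - 1 \<in> cyclic_route G p d v u"
  using assms by (auto simp: linear_route_def cyclic_route_def mem_forward_arc_iff)

text \<open>Finiteness accompanies the bound so that the linear case can compare cardinalities
  through a union.\<close>

lemma ex_order_of_seating:
  assumes G: "dataflow_graph G" and S: "correct_seating G W S"
  obtains p d where "node_order G p"
    "\<And>c. c < card (nodes G) \<Longrightarrow> finite (crossing G (cyclic_route G p d) c)"
    "\<And>c. c < card (nodes G) \<Longrightarrow> card (crossing G (cyclic_route G p d) c) \<le> W"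
proof -
  let ?s = "node_slot G S" and ?n = "card (nodes G)" and ?N = "slots S"
  have "finite (nodes G)" using G by (simp add: dataflow_graph_def)
  then obtain p where p: "bij_betw p (nodes G) {..<?n}"
    and mono: "\<And>a b. a \<in> nodes G \<Longrightarrow> b \<in> nodes G \<Longrightarrow> p a < p b \<longleftrightarrow> ?s a < ?s b"
    using ex_rank[OF _ inj_on_node_slot[OF S]] by metis
  have pless: "p a < ?n" if "a \<in> nodes G" for a
    using bij_betwE[OF p] that by auto
  define d where "d v u \<longleftrightarrow> forward_arc ?N (?s v) (?s u) \<subseteq> shadow G W S v" for v u
  \<comment> \<open>Membership in an arc depends only on order comparisons, and \<open>p\<close> and
    \<open>?s\<close> order the nodes alike. The cut after position \<open>p x\<close> thus
    corresponds to the cut after the slot of \<open>x\<close>.\<close>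
  have transfer: "p x \<in> forward_arc ?n (p a) (p b) \<longleftrightarrow> ?s x \<in> forward_arc ?N (?s a) (?s b)"
    if "a \<in> nodes G" "b \<in> nodes G" "x \<in> nodes G" for a b x
    using that by (simp add: mem_forward_arc_iff pless node_slot_less[OF S] mono
      flip: not_less)
  have sub: "crossing G (cyclic_route G p d) (p x) \<subseteq> {v. ?s x \<in> shadow G W S v}"
    if x: "x \<in> nodes G" for x
  proof
    fix v assume "v \<in> crossing G (cyclic_route G p d) (p x)"
    then obtain u where vu: "(v, u) \<in> dependences G" "p x \<in> cyclic_route G p d v u"
      by (auto simp: crossing_def)
    then have nodes: "v \<in> nodes G" "u \<in> nodes G"
      using G by (auto simp: dependences_def dataflow_graph_def nodes_def)
    show "v \<in> {v. ?s x \<in> shadow G W S v}"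
      \<comment> \<open>If \<open>d v u\<close> fails, joinedness puts the opposite arc inside the
        shadow, so the chosen route lies there either way.\<close>
      using vu(2) dependence_joined[OF G S vu(1)] nodes x
      by (auto simp: cyclic_route_def transfer d_def arc_joined_def split: if_splits)
  qed
  have bound: "finite (crossing G (cyclic_route G p d) c) \<and>
      card (crossing G (cyclic_route G p d) c) \<le> W" if "c < ?n" for c
  proof -
    from that p obtain x where x: "x \<in> nodes G" "c = p x"
      by (auto simp: bij_betw_def image_iff set_eq_iff)
    show ?thesis
      using sub[OF x(1)] card_shadows_le[OF S, of "?s x"] x(2)
      by (meson card_mono finite_subset order_trans)
  qed
  show thesis
    using that[of p d] p bound by (auto simp: node_order_def)
qed

lemma vcw_cyclic_le_window:
  assumes "dataflow_graph G" "correct_seating G W S"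
  shows "vcw_cyclic G \<le> W"
proof -
  obtain p d where "node_order G p"
    "\<And>c. c < card (nodes G) \<Longrightarrow> card (crossing G (cyclic_route G p d) c) \<le> W"
    using ex_order_of_seating[OF assms] by metis
  then show ?thesis
    by (auto intro!: vcw_cyclic_le SUP_nat_le simp: cyclic_width_def)
qed

lemma vcw_le_window:
  assumes G: "dataflow_graph G" and S: "correct_seating G W S"
  shows "vcw G \<le> 2 * W"
proof -
  let ?n = "card (nodes G)"
  obtain p d where p: "node_order G p"
    and fin: "\<And>c. c < ?n \<Longrightarrow> finite (crossing G (cyclic_route G p d) c)"
    and bound: "\<And>c. c < ?n \<Longrightarrow> card (crossing G (cyclic_route G p d) c) \<le> W"
    using ex_order_of_seating[OF assms] by metis
  have pless: "p a < ?n" if "a \<in> nodes G" for a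
    using p that by (auto simp: node_order_def dest: bij_betwE)
  have "card (crossing G (linear_route p) c) \<le> 2 * W" if c: "c < ?n - 1" for c
  proof -
    let ?X = "crossing G (cyclic_route G p d)"
    \<comment> \<open>A linear cut exists only if there are at least two nodes, so
      \<open>?n - 1\<close> is a genuine cyclic cut.\<close>
    have less: "c < ?n" "?n - 1 < ?n" using c by auto
    have "crossing G (linear_route p) c \<subseteq> ?X c \<union> ?X (?n - 1)"
    proof
      fix v assume "v \<in> crossing G (linear_route p) c"
      then obtain u where vu: "(v, u) \<in> dependences G" "c \<in> linear_route p v u"
        by (auto simp: crossing_def)
      then have "v \<in> nodes G" "u \<in> nodes G"
        using G by (auto simp: dependences_def dataflow_graph_def nodes_def)
      then show "v \<in> ?X c \<union> ?X (?n - 1)"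
        using vu linear_route_subset_cyclic_route[of p v G u c d] pless
        by (auto simp: crossing_def)
    qed
    then have "card (crossing G (linear_route p) c) \<le> card (?X c \<union> ?X (?n - 1))"
      using fin less by (intro card_mono) auto
    also have "\<dots> \<le> card (?X c) + card (?X (?n - 1))" by (rule card_Un_le)
    also have "\<dots> \<le> 2 * W" using bound[OF less(1)] bound[OF less(2)] by simp
    finally show ?thesis .
  qed
  then show ?thesis
    using p by (auto intro!: vcw_le SUP_nat_le simp: linear_width_def)
qed

theorem theorem7:
  fixes G :: "'v dataflow" and W :: nat and S :: "('v, 'r) seating"
  assumes "dataflow_graph G"
    and "correct_seating G W S"
  shows "vcw_cyclic G \<le> 2 * W \<and> vcw G \<le> 4 * W"
  using vcw_cyclic_le_window[OF assms] vcw_le_window[OF assms] by simp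

end
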